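(* Let $\mathcal{L}(\lambda)=L(\lambda)-g(\lambda)\mathbb{I}$, $\lambda\in\mathbb{R}$, be a (real analytic) Hermitian matrix pencil, where $L(\lambda)=\sum_{k=0}^{p}\lambda^kL_k$ with $L_0,\dots,L_p$ complex Hermitian $n\times n$ matrices, $g(\lambda)=\sum_{k=0}^{q}\lambda^kg_k$ with $g_0,\dots,g_q$ real constants, $\mathbb{I}$ is the $n\times n$ identity matrix, and $\lambda^pL_p\neq\lambda^qg_q\mathbb{I}$. Let $L_p$ be invertible. Then the counts $Z^{\downarrow}_{-\infty}(\mathcal{L})$ and $Z^{\downarrow}_{+\infty}(\mathcal{L})$ are given as follows: (1) if $q>p$, $q$ even, $g_q>0$: $Z^{\downarrow}_{-\infty}=n$ and $Z^{\downarrow}_{+\infty}=n$; (2) if $q>p$, $q$ even, $g_q<0$: $Z^{\downarrow}_{-\infty}=0$ and $Z^{\downarrow}_{+\infty}=0$; (3) if $q>p$, $q$ odd, $g_q>0$: $Z^{\downarrow}_{-\infty}=0$ and $Z^{\downarrow}_{+\infty}=n$; (4) if $q>p$, $q$ odd, $g_q<0$: $Z^{\downarrow}_{-\infty}=n$ and $Z^{\downarrow}_{+\infty}=0$; (5) if $q<p$: $Z^{\downarrow}_{-\infty}=n\big((-1)^pL_p\big)$ and $Z^{\downarrow}_{+\infty}=n(L_p)$; (6) if $q=p$: $Z^{\downarrow}_{-\infty}=n\big((-1)^p(L_p-g_p\mathbb{I})\big)$ and $Z^{\downarrow}_{+\infty}=n(L_p-g_p\mathbb{I})$.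
   Context: For a Hermitian matrix $A$, $n(A)$ (with an argument) denotes the number of negative eigenvalues of $A$ counted with multiplicity; $n$ without argument is the matrix size. By analytic perturbation theory the eigenvalues of the Hermitian matrix $\mathcal{L}(\lambda)$, $\lambda\in\mathbb{R}$, counted with multiplicity, are given by $n$ real analytic functions (eigenvalue curves) $\mu=\mu(\lambda)$. $Z^{\downarrow}_{-\infty}(\mathcal{L})$ (respectively $Z^{\downarrow}_{+\infty}(\mathcal{L})$) is the number, counting multiplicity, of eigenvalue curves with $\mu(\lambda)<0$ for $\lambda\in(-\infty,-K)$ (respectively $\lambda\in(K,\infty)$) for a sufficiently large $K>0$.
   Formalization: In case (6) the matrix L_p − g_p I is additionally assumed invertible; without this the claim fails, e.g. for L_1 = diag(1,2), L_0 = diag(−1,0), g(λ) = λ, where Z↓ at +∞ is 1 but n(L_1 − g_1 I) = 0. *)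

theory Defs
  imports
    "HOL-Analysis.Analysis"
    "Jordan_Normal_Form.Schur_Decomposition"
begin

definition hermitian_mat :: "complex mat \<Rightarrow> bool" where
  "hermitian_mat A \<longleftrightarrow> square_mat A \<and> mat_adjoint A = A"

definition alg_multiplicity :: "complex mat \<Rightarrow> complex \<Rightarrow> nat" where
  "alg_multiplicity A z = Polynomial.order z (char_poly A)"

text \<open>Intended for Hermitian matrices, all of whose eigenvalues are real.\<close>

definition num_neg_eigenvalues :: "complex mat \<Rightarrow> nat" where
  "num_neg_eigenvalues A =
     (\<Sum>x \<in> {x::real. x < 0 \<and> eigenvalue A (complex_of_real x)}.
        alg_multiplicity A (complex_of_real x))"

text \<open>Matrices of all sizes share one type, which has no additive unit, so the matrix sum
  is taken entrywise.\<close>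

definition matrix_polynomial :: "nat \<Rightarrow> nat \<Rightarrow> (nat \<Rightarrow> complex mat) \<Rightarrow> real \<Rightarrow> complex mat" where
  "matrix_polynomial n p L t =
     mat n n (\<lambda>(i, j). \<Sum>k\<le>p. complex_of_real (t ^ k) * L k $$ (i, j))"

definition scalar_polynomial :: "nat \<Rightarrow> (nat \<Rightarrow> real) \<Rightarrow> real \<Rightarrow> real" where
  "scalar_polynomial q g t = (\<Sum>k\<le>q. t ^ k * g k)"

definition pencil ::
  "nat \<Rightarrow> nat \<Rightarrow> (nat \<Rightarrow> complex mat) \<Rightarrow> nat \<Rightarrow> (nat \<Rightarrow> real) \<Rightarrow> real \<Rightarrow> complex mat" where
  "pencil n p L q g t =
     matrix_polynomial n p L t - complex_of_real (scalar_polynomial q g t) \<cdot>\<^sub>m 1\<^sub>m n"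

text \<open>The library predicate \<open>analytic_on\<close> is only available for complex functions.\<close>

definition real_analytic :: "(real \<Rightarrow> real) \<Rightarrow> bool" where
  "real_analytic f \<longleftrightarrow>
     (\<forall>x0. \<exists>r>0. \<exists>a. \<forall>x. \<bar>x - x0\<bar> < r \<longrightarrow> (\<lambda>k. a k * (x - x0) ^ k) sums f x)"

text \<open>The curves are \<open>\<mu> 0, \<dots>, \<mu> (n - 1)\<close>. Through every point \<open>(t, z)\<close> there pass as many of
  them as the multiplicity of \<open>z\<close> as an eigenvalue of \<open>A t\<close>; in particular there are none
  if \<open>z\<close> is not an eigenvalue. For a real analytic Hermitian family such curves exist by
  Rellich's theorem and are unique up to the order of the indices.\<close>

definition eigenvalue_curves ::
  "nat \<Rightarrow> (real \<Rightarrow> complex mat) \<Rightarrow> (nat \<Rightarrow> real \<Rightarrow> real) \<Rightarrow> bool" where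
  "eigenvalue_curves n A \<mu> \<longleftrightarrow>
     (\<forall>i<n. real_analytic (\<mu> i)) \<and>
     (\<forall>t z. alg_multiplicity (A t) z = card {i. i < n \<and> complex_of_real (\<mu> i t) = z})"

text \<open>Curves are counted by index, hence with multiplicity.\<close>

definition Z_down_minf :: "nat \<Rightarrow> (nat \<Rightarrow> real \<Rightarrow> real) \<Rightarrow> nat" where
  "Z_down_minf n \<mu> = card {i. i < n \<and> (\<exists>K>0. \<forall>t < - K. \<mu> i t < 0)}"

definition Z_down_pinf :: "nat \<Rightarrow> (nat \<Rightarrow> real \<Rightarrow> real) \<Rightarrow> nat" where
  "Z_down_pinf n \<mu> = card {i. i < n \<and> (\<exists>K>0. \<forall>t > K. \<mu> i t < 0)}"

end

theory Submission
  imports Defs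
begin

text \<open>Divide the pencil by \<open>t ^ max p q\<close>: as \<open>t\<close> tends to \<open>\<infinity>\<close> it converges to its leading
  coefficient \<open>B\<close>, which is invertible, and so its characteristic polynomial converges
  pointwise to that of \<open>B\<close>. Evaluation at \<open>0\<close> shows that no curve vanishes for large \<open>t\<close>, hence
  each one has an eventual sign; evaluation at \<open>\<i>\<close> shows that the rescaled curves are bounded.
  Along a suitable sequence they therefore converge to the eigenvalues of \<open>B\<close>, which are
  nonzero and keep the signs of the curves. The end \<open>-\<infinity>\<close> is reached by \<open>t \<mapsto> -t\<close>.\<close>

section \<open>Characteristic polynomials with real roots\<close>

text \<open>Over the complex numbers a polynomial is its leading coefficient times the product of
  its linear factors raised to the root orders, and the roots are the points of nonzero
  order.\<close>

lemma complex_poly_eqI_order: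
  fixes P Q :: "complex poly"
  assumes "P \<noteq> 0" "Q \<noteq> 0" "lead_coeff P = lead_coeff Q"
    and ord: "\<And>z. Polynomial.order z P = Polynomial.order z Q"
  shows "P = Q"
proof -
  have "{z. poly P z = 0} = {z. poly Q z = 0}"
    using assms by (simp add: order_root)
  then have "Polynomial.smult (lead_coeff P) (\<Prod>z|poly P z = 0. [:-z, 1:] ^ Polynomial.order z P)
      = Polynomial.smult (lead_coeff Q) (\<Prod>z|poly Q z = 0. [:-z, 1:] ^ Polynomial.order z Q)"
    using assms(3) ord by simp
  then show ?thesis
    by (simp only: complex_poly_decompose)
qed

lemma monic_prod_linear_factors:
  "lead_coeff (\<Prod>i<n. [:- a i, 1:]) = (1 :: 'a::idom)"
  by (simp add: lead_coeff_prod)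

lemma order_prod_linear_factors:
  fixes a :: "nat \<Rightarrow> 'a::field"
  shows "Polynomial.order z (\<Prod>i<n. [:- a i, 1:]) = card {i. i < n \<and> a i = z}"
proof (induction n)
  case (Suc n)
  have nz: "(\<Prod>i<Suc n. [:- a i, 1:]) \<noteq> 0"
    by (subst prod_zero_iff) auto
  have set: "{i. i < Suc n \<and> a i = z} =
      (if a n = z then insert n {i. i < n \<and> a i = z} else {i. i < n \<and> a i = z})"
    by (auto simp: less_Suc_eq)
  have "Polynomial.order z (\<Prod>i<Suc n. [:- a i, 1:]) =
      card {i. i < n \<and> a i = z} + (if a n = z then 1 else 0)"
    unfolding prod.lessThan_Suc order_mult[OF nz[unfolded prod.lessThan_Suc]] Suc.IH
    by (simp add: order_linear')
  then show ?case
    unfolding set by simp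
qed simp

text \<open>Both sides are monic with the same root orders. This turns the multiplicity condition of
  \<open>eigenvalue_curves\<close> into a polynomial identity that can be evaluated at any
  point.\<close>

lemma char_poly_eq_prod_linear_factors:
  assumes "A \<in> carrier_mat n n"
    and "\<And>z. alg_multiplicity A z = card {i. i < n \<and> a i = z}"
  shows "char_poly A = (\<Prod>i<n. [:- a i, 1:])"
proof (rule complex_poly_eqI_order)
  show "lead_coeff (char_poly A) = lead_coeff (\<Prod>i<n. [:- a i, 1:])"
    using degree_monic_char_poly[OF assms(1)] by (simp add: monic_prod_linear_factors)
  show "char_poly A \<noteq> 0"
    using degree_monic_char_poly[OF assms(1)] by auto
qed (use assms(2) in \<open>simp_all add: order_prod_linear_factors alg_multiplicity_def\<close>)

text \<open>The fibres of \<open>l\<close> over the negative eigenvalues partition the indices with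
  \<open>l i < 0\<close>, and the size of each fibre is an algebraic multiplicity.\<close>

lemma num_neg_eigenvalues_eq_card:
  assumes B: "B \<in> carrier_mat n n"
    and cp: "char_poly B = (\<Prod>i<n. [:- complex_of_real (l i), 1:])"
  shows "num_neg_eigenvalues B = card {i. i < n \<and> l i < 0}"
proof -
  have ev: "eigenvalue B (complex_of_real x) \<longleftrightarrow> (\<exists>i<n. x = l i)" for x
    unfolding eigenvalue_root_char_poly[OF B] cp by (auto simp: poly_prod)
  have mult: "alg_multiplicity B (complex_of_real x) = card {i. i < n \<and> l i = x}" for x
    unfolding alg_multiplicity_def cp order_prod_linear_factors by simp
  let ?X = "{x. x < 0 \<and> (\<exists>i<n. x = l i)}"
  have "num_neg_eigenvalues B = (\<Sum>x\<in>?X. card {i. i < n \<and> l i = x})"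
    unfolding num_neg_eigenvalues_def ev mult ..
  also have "\<dots> = card (\<Union>x\<in>?X. {i. i < n \<and> l i = x})"
    by (rule card_UN_disjoint[symmetric]) auto
  also have "(\<Union>x\<in>?X. {i. i < n \<and> l i = x}) = {i. i < n \<and> l i < 0}"
    by auto
  finally show ?thesis .
qed

lemma num_neg_eigenvalues_scalar:
  "num_neg_eigenvalues (complex_of_real c \<cdot>\<^sub>m 1\<^sub>m n) = (if c < 0 then n else 0)"
proof -
  let ?B = "complex_of_real c \<cdot>\<^sub>m 1\<^sub>m n"
  have B: "?B \<in> carrier_mat n n"
    by simp
  have "char_poly ?B = (\<Prod>a\<leftarrow>diag_mat ?B. [:- a, 1:])"
    by (rule char_poly_upper_triangular[OF B]) auto
  also have "\<dots> = prod_list (map (\<lambda>i. [:- complex_of_real c, 1:]) [0..<n])"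
    by (intro arg_cong[of _ _ prod_list]) (simp add: diag_mat_def)
  also have "\<dots> = (\<Prod>i<n. [:- complex_of_real c, 1:])"
    by (simp add: prod.distinct_set_conv_list[symmetric] atLeast0LessThan)
  finally show ?thesis
    using num_neg_eigenvalues_eq_card[OF B, of "\<lambda>_. c"] by simp
qed

lemma invertible_mat_imp_det_nonzero:
  fixes A :: "'a::idom mat"
  assumes "invertible_mat A" and A: "A \<in> carrier_mat n n"
  shows "det A \<noteq> 0"
proof -
  from assms obtain C where C: "A * C = 1\<^sub>m n" and "C * A = 1\<^sub>m (dim_row C)"
    unfolding invertible_mat_def inverts_mat_def by auto
  \<comment> \<open>The column count of \<open>C\<close> is read off from \<open>A * C\<close>, its
    row count from the column count of \<open>C * A\<close>.\<close>
  then have "C \<in> carrier_mat n n"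
    using A by (metis carrier_matD(2) carrier_matI index_mult_mat(3) index_one_mat(3))
  then have "det A * det C = 1"
    using det_mult[OF A, of C] C by simp
  then show ?thesis
    by auto
qed

section \<open>Limits of characteristic polynomials\<close>

text \<open>From s x I - A = s (x I - A / s), the determinant gains one factor \<open>s\<close> per
  row.\<close>

lemma char_poly_eval_scale:
  fixes A :: "'a::field mat"
  assumes A: "A \<in> carrier_mat n n" and "s \<noteq> 0"
  shows "poly (char_poly A) (s * x) = s ^ n * poly (char_poly (inverse s \<cdot>\<^sub>m A)) x"
proof -
  have "- char_matrix A (s * x) = s \<cdot>\<^sub>m (- char_matrix (inverse s \<cdot>\<^sub>m A) x)"
    using assms by (intro eq_matI) (auto simp: char_matrix_def field_simps)
  then show ?thesis
    using A by (simp add: char_poly_matrix[of _ n] char_matrix_def)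
qed

text \<open>By the Leibniz formula the determinant is a polynomial in the entries, hence continuous
  in them.\<close>

lemma char_poly_eval_tendsto:
  fixes N :: "'b \<Rightarrow> 'a::real_normed_field mat"
  assumes N: "\<And>t. N t \<in> carrier_mat n n" and B: "B \<in> carrier_mat n n"
    and lim: "\<And>i j. i < n \<Longrightarrow> j < n \<Longrightarrow> ((\<lambda>t. N t $$ (i, j)) \<longlongrightarrow> B $$ (i, j)) F"
  shows "((\<lambda>t. poly (char_poly (N t)) x) \<longlongrightarrow> poly (char_poly B) x) F"
proof -
  have carr: "- char_matrix M x \<in> carrier_mat n n" if "M \<in> carrier_mat n n" for M :: "'a mat"
    using that by simp
  have entry: "(- char_matrix M x) $$ (i, j) = (if i = j then x else 0) - M $$ (i, j)"
    if "M \<in> carrier_mat n n" "i < n" "j < n" for M :: "'a mat" and i j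
    using that by (auto simp: char_matrix_def)
  have "((\<lambda>t. det (- char_matrix (N t) x)) \<longlongrightarrow> det (- char_matrix B x)) F"
    unfolding det_def'[OF carr[OF N]] det_def'[OF carr[OF B]]
  proof (intro tendsto_sum tendsto_mult tendsto_const tendsto_prod)
    fix \<pi> i assume "\<pi> \<in> {\<pi>. \<pi> permutes {0..<n}}" and i: "i \<in> {0..<n}"
    then have "\<pi> i < n"
      by (simp add: permutes_in_image[of \<pi> "{0..<n}" i, simplified])
    with i show "((\<lambda>t. (- char_matrix (N t) x) $$ (i, \<pi> i)) \<longlongrightarrow> (- char_matrix B x) $$ (i, \<pi> i)) F"
      by (simp add: entry N B del: index_uminus_mat) (auto intro!: tendsto_diff tendsto_minus lim)
  qed
  then show ?thesis
    by (simp add: char_poly_matrix[OF N] char_poly_matrix[OF B])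
qed

section \<open>Signs of the curves\<close>

text \<open>Bolzano-Weierstrass, applied once per index to the subsequence found so far. All limits
  must live on one subsequence so that a product over the curves can pass to its limit.\<close>

lemma common_convergent_subsequence:
  fixes f :: "nat \<Rightarrow> nat \<Rightarrow> 'a::heine_borel"
  assumes "\<And>i. i < n \<Longrightarrow> bounded (range (f i))"
  obtains r l where "strict_mono (r :: nat \<Rightarrow> nat)" "\<And>i. i < n \<Longrightarrow> (f i \<circ> r) \<longlonglongrightarrow> l i"
proof -
  have "\<exists>r l. strict_mono (r :: nat \<Rightarrow> nat) \<and> (\<forall>i<n. (f i \<circ> r) \<longlonglongrightarrow> l i)"
    using assms
  proof (induction n)
    case 0
    show ?case
      by (auto intro: exI[of _ id] strict_mono_id)
  next
    case (Suc n)
    then obtain r l where r: "strict_mono (r :: nat \<Rightarrow> nat)"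
      and l: "\<And>i. i < n \<Longrightarrow> (f i \<circ> r) \<longlonglongrightarrow> l i"
      by (metis less_SucI)
    have "bounded (range (f n \<circ> r))"
      by (rule bounded_subset[OF Suc.prems[of n]]) auto
    from bounded_imp_convergent_subsequence[OF this]
    obtain m r' where r': "strict_mono (r' :: nat \<Rightarrow> nat)" and m: "(f n \<circ> r \<circ> r') \<longlonglongrightarrow> m"
      by auto
    have "(f i \<circ> (r \<circ> r')) \<longlonglongrightarrow> (if i = n then m else l i)" if "i < Suc n" for i
    proof (cases "i = n")
      case True
      then show ?thesis
        using m by (simp add: o_assoc)
    next
      case False
      then show ?thesis
        using LIMSEQ_subseq_LIMSEQ[OF l r', of i] that by (simp add: o_assoc)
    qed
    then show ?case
      using strict_mono_o[OF r r']
      by (intro exI[of _ "r \<circ> r'"] exI[of _ "\<lambda>i. if i = n then m else l i"]) blast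
  qed
  then show ?thesis
    using that by metis
qed

lemma real_analytic_imp_continuous_on:
  assumes "real_analytic f"
  shows "continuous_on S f"
proof (rule continuous_at_imp_continuous_on, rule ballI)
  fix x0
  from assms obtain r a where r: "r > 0"
    and a: "\<And>x. \<bar>x - x0\<bar> < r \<Longrightarrow> (\<lambda>k. a k * (x - x0) ^ k) sums f x"
    unfolding real_analytic_def by metis
  have "summable (\<lambda>k. a k * (r / 2) ^ k)"
    using a[of "x0 + r / 2"] r by (auto simp: sums_iff)
  \<comment> \<open>Convergence at distance \<open>r / 2\<close> gives continuity at the centre 0,
    written \<open>x0 - x0\<close> to compose with the shift by \<open>x0\<close>.\<close>
  then have "isCont (\<lambda>h. \<Sum>k. a k * h ^ k) (x0 - x0)"
    by (rule isCont_powser) (use r in simp)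
  then have "isCont (\<lambda>x. \<Sum>k. a k * (x - x0) ^ k) x0"
    by (rule isCont_o2[rotated]) simp
  moreover have "\<forall>\<^sub>F x in nhds x0. (\<Sum>k. a k * (x - x0) ^ k) = f x"
    unfolding eventually_nhds_metric
    using r a by (intro exI[of _ r]) (auto simp: dist_real_def sums_iff)
  ultimately show "isCont f x0"
    using isCont_cong by fastforce
qed

text \<open>Each factor has imaginary part 1, so its modulus is at least 1 and the product dominates
  any single factor, whose real part is \<open>- \<nu> i\<close>. Hence bounding a monic real-rooted
  polynomial at \<open>\<i>\<close> bounds all its roots.\<close>

lemma prod_i_minus_bound:
  fixes \<nu> :: "nat \<Rightarrow> real"
  assumes "i < n"
  shows "\<bar>\<nu> i\<bar> \<le> cmod (\<Prod>j<n. \<i> - complex_of_real (\<nu> j))"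
proof -
  have ge1: "1 \<le> cmod (\<i> - complex_of_real y)" for y
    using abs_Im_le_cmod[of "\<i> - complex_of_real y"] by simp
  have "\<bar>\<nu> i\<bar> * 1 \<le> cmod (\<i> - complex_of_real (\<nu> i)) * (\<Prod>j\<in>{..<n} - {i}. cmod (\<i> - complex_of_real (\<nu> j)))"
    using abs_Re_le_cmod[of "\<i> - complex_of_real (\<nu> i)"]
    by (intro mult_mono prod_ge_1 ge1) auto
  also have "\<dots> = cmod (\<Prod>j<n. \<i> - complex_of_real (\<nu> j))"
    using assms by (subst prod.remove[of "{..<n}" i]) (auto simp: norm_mult prod_norm)
  finally show ?thesis
    by simp
qed

text \<open>Intermediate values: the image of the ray is connected and misses 0.\<close>

lemma nonzero_constant_sign:
  fixes f :: "real \<Rightarrow> real"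
  assumes "continuous_on {K<..} f" and "\<And>t. t > K \<Longrightarrow> f t \<noteq> 0"
    and "a > K" "b > K" "f a < 0"
  shows "f b < 0"
proof (rule ccontr)
  assume "\<not> f b < 0"
  then have "0 \<in> {f a..f b}"
    using assms by auto
  moreover have "connected (f ` {K<..})"
    using assms(1) by (intro connected_continuous_image) auto
  ultimately have "0 \<in> f ` {K<..}"
    using assms connected_contains_Icc[of "f ` {K<..}" "f a" "f b"] by blast
  then show False
    using assms(2) by fastforce
qed

text \<open>Stated for a general matrix family so that it serves both the pencil and its reflection
  under \<open>t \<mapsto> -t\<close>.\<close>

lemma Z_down_pinf_eq_num_neg_eigenvalues:
  fixes A :: "real \<Rightarrow> complex mat" and s :: "real \<Rightarrow> real"
  assumes A: "\<And>t. A t \<in> carrier_mat n n" and B: "B \<in> carrier_mat n n" and det: "det B \<noteq> 0"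
    and cont: "\<And>i. i < n \<Longrightarrow> continuous_on UNIV (\<mu> i)"
    and mult: "\<And>t z. alg_multiplicity (A t) z = card {i. i < n \<and> complex_of_real (\<mu> i t) = z}"
    and pos: "\<forall>\<^sub>F t in at_top. s t > 0"
    and lim: "\<And>i j. i < n \<Longrightarrow> j < n \<Longrightarrow>
      ((\<lambda>t. A t $$ (i, j) / complex_of_real (s t)) \<longlongrightarrow> B $$ (i, j)) at_top"
  shows "Z_down_pinf n \<mu> = num_neg_eigenvalues B"
proof -
  define N where "N t = inverse (complex_of_real (s t)) \<cdot>\<^sub>m A t" for t
  define \<nu> where "\<nu> i t = \<mu> i t / s t" for i t
  have N: "N t \<in> carrier_mat n n" for t
    using A by (simp add: N_def)
  \<comment> \<open>The roots for \<open>N t\<close> are the rescaled curves; the factor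
    \<open>s t ^ n\<close> from scaling cancels.\<close>
  have eval: "poly (char_poly (N t)) x = (\<Prod>i<n. x - complex_of_real (\<nu> i t))" if "s t > 0" for t x
  proof -
    have "complex_of_real (s t) ^ n * poly (char_poly (N t)) x
        = (\<Prod>i<n. complex_of_real (s t) * x - complex_of_real (\<mu> i t))"
      using char_poly_eval_scale[OF A[of t], of "complex_of_real (s t)" x] that
        char_poly_eq_prod_linear_factors[OF A mult]
      by (simp add: N_def poly_prod)
    also have "\<dots> = (\<Prod>i<n. complex_of_real (s t) * (x - complex_of_real (\<nu> i t)))"
      using that by (intro prod.cong) (auto simp: \<nu>_def field_simps)
    also have "\<dots> = complex_of_real (s t) ^ n * (\<Prod>i<n. x - complex_of_real (\<nu> i t))"
      by (simp add: prod.distrib)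
    finally show ?thesis
      using that by simp
  qed
  have lim_eval: "((\<lambda>t. poly (char_poly (N t)) x) \<longlongrightarrow> poly (char_poly B) x) at_top" for x
  proof (rule char_poly_eval_tendsto[OF N B])
    fix i j assume "i < n" "j < n"
    with lim[OF this] show "((\<lambda>t. N t $$ (i, j)) \<longlongrightarrow> B $$ (i, j)) at_top"
      using A carrier_matD[OF A] by (simp add: N_def divide_inverse mult.commute)
  qed
  have B0: "poly (char_poly B) 0 \<noteq> 0"
  proof -
    have "char_matrix B 0 = B"
      using B by (intro eq_matI) (auto simp: char_matrix_def)
    then show ?thesis
      using det eigenvalue_root_char_poly[OF B, of 0] eigenvalue_det[OF B, of 0] by simp
  qed
  \<comment> \<open>The summand 1 puts the limit strictly below \<open>C\<close>, so the bound holds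
    eventually.\<close>
  define C where "C = cmod (poly (char_poly B) \<i>) + 1"
  have "\<forall>\<^sub>F t in at_top. poly (char_poly (N t)) 0 \<noteq> 0"
    by (rule tendsto_imp_eventually_ne[OF lim_eval B0])
  moreover have "\<forall>\<^sub>F t in at_top. cmod (poly (char_poly (N t)) \<i>) < C"
    by (rule order_tendstoD(2)[OF tendsto_norm[OF lim_eval]]) (simp add: C_def)
  ultimately have "\<forall>\<^sub>F t in at_top. s t > 0 \<and> poly (char_poly (N t)) 0 \<noteq> 0 \<and>
      cmod (poly (char_poly (N t)) \<i>) < C"
    using pos by eventually_elim auto
  then obtain K where K: "\<And>t. t > K \<Longrightarrow> s t > 0 \<and> poly (char_poly (N t)) 0 \<noteq> 0 \<and>
      cmod (poly (char_poly (N t)) \<i>) < C"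
    unfolding eventually_at_top_dense by blast
  \<comment> \<open>At 0 the characteristic polynomial is the product of all
    \<open>- \<nu> i t\<close>, so one vanishing curve would make it vanish.\<close>
  have nz: "\<mu> i t \<noteq> 0" if "i < n" "t > K" for i t
    using K[OF that(2)] that(1) eval[of t 0] by (auto simp: \<nu>_def)
  have bound: "\<bar>\<nu> i t\<bar> \<le> C" if "i < n" "t > K" for i t
    using K[OF that(2)] prod_i_minus_bound[OF that(1), of "\<lambda>i. \<nu> i t"] eval[of t \<i>] by simp
  \<comment> \<open>The offset 1 keeps even \<open>T 0\<close> beyond \<open>K\<close>, so the
    bounds hold at every index.\<close>
  define T where "T k = K + 1 + real k" for k :: nat
  have T: "T k > K" for k
    by (simp add: T_def)
  have "bounded (range (\<lambda>k. \<nu> i (T k)))" if "i < n" for i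
    using bound[OF that T] by (auto simp: bounded_iff)
  then obtain r l where r: "strict_mono (r :: nat \<Rightarrow> nat)"
    and l: "\<And>i. i < n \<Longrightarrow> ((\<lambda>k. \<nu> i (T k)) \<circ> r) \<longlonglongrightarrow> l i"
    using common_convergent_subsequence[of n "\<lambda>i k. \<nu> i (T k)"] by blast
  have "filterlim T at_top sequentially"
    unfolding T_def by (rule filterlim_tendsto_add_at_top[OF tendsto_const filterlim_real_sequentially])
  then have Tr: "filterlim (T \<circ> r) at_top sequentially"
    using filterlim_compose[OF _ filterlim_subseq[OF r]] by (simp add: o_def)
  \<comment> \<open>The same limit is computed twice: through the matrices, and through the factors
    along the common subsequence.\<close>
  have poly_B: "poly (char_poly B) x = (\<Prod>i<n. x - complex_of_real (l i))" for x
  proof (rule LIMSEQ_unique)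
    show "(\<lambda>k. poly (char_poly (N (T (r k)))) x) \<longlonglongrightarrow> poly (char_poly B) x"
      using filterlim_compose[OF lim_eval Tr] by (simp add: o_def)
    have "poly (char_poly (N (T (r k)))) x = (\<Prod>i<n. x - complex_of_real (\<nu> i (T (r k))))" for k
      using eval K[OF T] by blast
    then show "(\<lambda>k. poly (char_poly (N (T (r k)))) x) \<longlonglongrightarrow> (\<Prod>i<n. x - complex_of_real (l i))"
      using l by (auto simp: o_def intro!: tendsto_intros)
  qed
  have cp: "char_poly B = (\<Prod>i<n. [:- complex_of_real (l i), 1:])"
    using poly_B by (intro poly_eq_poly_eq_iff[THEN iffD1] ext) (simp add: poly_prod)
  have l_nz: "l i \<noteq> 0" if "i < n" for i
    using B0 that poly_B[of 0] by auto
  have sign: "(\<exists>K>0. \<forall>t>K. \<mu> i t < 0) \<longleftrightarrow> l i < 0" if i: "i < n" for i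
  proof
    assume "\<exists>K>0. \<forall>t>K. \<mu> i t < 0"
    then have "\<forall>\<^sub>F t in at_top. \<mu> i t < 0"
      by (auto simp: eventually_at_top_dense)
    with pos have "\<forall>\<^sub>F t in at_top. \<nu> i t \<le> 0"
      by eventually_elim (simp add: \<nu>_def divide_nonpos_pos)
    then have "\<forall>\<^sub>F k in sequentially. ((\<lambda>k. \<nu> i (T k)) \<circ> r) k \<le> 0"
      using eventually_compose_filterlim[OF _ Tr] by (simp add: o_def)
    \<comment> \<open>The limit keeps only the weak inequality; \<open>l_nz\<close> makes it
      strict.\<close>
    then have "l i \<le> 0"
      using tendsto_upperbound[OF l[OF i]] by simp
    then show "l i < 0"
      using l_nz[OF i] by simp
  next
    assume "l i < 0"
    then have "\<forall>\<^sub>F k in sequentially. ((\<lambda>k. \<nu> i (T k)) \<circ> r) k < 0"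
      using order_tendstoD(2)[OF l[OF i]] by blast
    then obtain k where "\<nu> i (T (r k)) < 0"
      by (auto simp: eventually_sequentially)
    then have neg: "\<mu> i (T (r k)) < 0"
      using K[OF T] by (simp add: \<nu>_def divide_less_0_iff not_less_iff_gr_or_eq)
        (metis less_asym)
    \<comment> \<open>One negative value beyond \<open>K\<close> suffices, since the curve has no
      zero there.\<close>
    have "\<mu> i t < 0" if "t > K" for t
      using nonzero_constant_sign[OF continuous_on_subset[OF cont[OF i]] nz[OF i] T that neg] by blast
    \<comment> \<open>\<open>K\<close> itself may be nonpositive, while the count asks for a
      positive threshold.\<close>
    then show "\<exists>K>0. \<forall>t>K. \<mu> i t < 0"
      by (intro exI[of _ "max K 1"]) auto
  qed
  show ?thesis
    unfolding num_neg_eigenvalues_eq_card[OF B cp] Z_down_pinf_def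
    using sign by (intro arg_cong[of _ _ card]) auto
qed

lemma Z_down_minf_eq_reflect: "Z_down_minf n \<mu> = Z_down_pinf n (\<lambda>i t. \<mu> i (- t))"
proof -
  have "(\<forall>t < - K. \<mu> i t < 0) \<longleftrightarrow> (\<forall>t > K. \<mu> i (- t) < 0)" for i K
    by (metis add.inverse_inverse neg_less_iff_less)
  then show ?thesis
    unfolding Z_down_minf_def Z_down_pinf_def by simp
qed

section \<open>The leading coefficient of a pencil\<close>

lemma polynomial_over_power_tendsto:
  fixes c :: "nat \<Rightarrow> complex"
  shows "((\<lambda>t::real. (\<Sum>k\<le>r. complex_of_real (t ^ k) * c k) / complex_of_real (t ^ r)) \<longlongrightarrow> c r) at_top"
proof -
  have "((\<lambda>t::real. complex_of_real (t ^ k / t ^ r) * c k) \<longlongrightarrow> (if k = r then c k else 0)) at_top"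
    if "k \<le> r" for k
  proof (cases "k = r")
    case True
    \<comment> \<open>The restriction to positive \<open>t\<close> avoids \<open>t = 0\<close>,
      where the quotient is 0 by convention if \<open>r > 0\<close>.\<close>
    have "\<forall>\<^sub>F t::real in at_top. complex_of_real (t ^ k / t ^ r) * c k = c k"
      using eventually_gt_at_top[of 0] by eventually_elim (simp add: True)
    then show ?thesis
      by (simp only: True simp_thms if_True tendsto_eventually)
  next
    case False
    with that have k: "k < r"
      by simp
    have "((\<lambda>t::real. t ^ k / t ^ r) \<longlongrightarrow> 0) at_top"
    proof (rule Lim_transform_eventually)
      show "((\<lambda>t::real. inverse (t ^ (r - k))) \<longlongrightarrow> 0) at_top"
        using k by (intro tendsto_inverse_0_at_top filterlim_pow_at_top filterlim_ident) auto
      show "\<forall>\<^sub>F t::real in at_top. inverse (t ^ (r - k)) = t ^ k / t ^ r"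
        using eventually_gt_at_top[of 0]
        by eventually_elim (use k in \<open>simp add: power_diff\<close>)
    qed
    then have "((\<lambda>t::real. complex_of_real (t ^ k / t ^ r) * c k) \<longlongrightarrow> complex_of_real 0 * c k) at_top"
      by (intro tendsto_intros)
    then show ?thesis
      using False by simp
  qed
  then have "((\<lambda>t::real. \<Sum>k\<le>r. complex_of_real (t ^ k / t ^ r) * c k)
      \<longlongrightarrow> (\<Sum>k\<le>r. if k = r then c k else 0)) at_top"
    by (intro tendsto_sum) auto
  then show ?thesis
    by (simp add: sum_divide_distrib)
qed

text \<open>The coefficient of \<open>t ^ k\<close> in the pencil. Values of \<open>L\<close> beyond
  \<open>p\<close> and of \<open>g\<close> beyond \<open>q\<close> are arbitrary, so they are cut to
  zero; both sums can then run up to \<open>max p q\<close>.\<close>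

definition pencil_coeff ::
  "nat \<Rightarrow> nat \<Rightarrow> (nat \<Rightarrow> complex mat) \<Rightarrow> nat \<Rightarrow> (nat \<Rightarrow> real) \<Rightarrow> nat \<Rightarrow> complex mat" where
  "pencil_coeff n p L q g k =
     (if k \<le> p then L k else 0\<^sub>m n n) - (if k \<le> q then complex_of_real (g k) else 0) \<cdot>\<^sub>m 1\<^sub>m n"

lemma pencil_carrier [simp]: "pencil n p L q g t \<in> carrier_mat n n"
  by (simp add: pencil_def minus_carrier_mat)

lemma pencil_coeff_carrier [simp]: "pencil_coeff n p L q g k \<in> carrier_mat n n"
  by (simp add: pencil_coeff_def minus_carrier_mat)

lemma pencil_entry:
  assumes L: "\<And>k. k \<le> p \<Longrightarrow> L k \<in> carrier_mat n n" and ij: "i < n" "j < n"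
  shows "pencil n p L q g t $$ (i, j) =
    (\<Sum>k\<le>max p q. complex_of_real (t ^ k) * pencil_coeff n p L q g k $$ (i, j))"
proof -
  let ?r = "max p q"
  have L_sum: "(\<Sum>k\<le>p. complex_of_real (t ^ k) * L k $$ (i, j)) =
      (\<Sum>k\<le>?r. complex_of_real (t ^ k) * (if k \<le> p then L k $$ (i, j) else 0))"
    by (rule sum.mono_neutral_cong_left) auto
  have "scalar_polynomial q g t = (\<Sum>k\<le>?r. t ^ k * (if k \<le> q then g k else 0))"
    unfolding scalar_polynomial_def by (rule sum.mono_neutral_cong_left) auto
  then have g_sum: "complex_of_real (scalar_polynomial q g t) * (if i = j then 1 else 0) =
      (\<Sum>k\<le>?r. complex_of_real (t ^ k) * (if k \<le> q then complex_of_real (g k) else 0) * (if i = j then 1 else 0))"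
    by (auto simp: if_distrib[of complex_of_real] intro!: sum.cong)
  have "pencil n p L q g t $$ (i, j) = (\<Sum>k\<le>p. complex_of_real (t ^ k) * L k $$ (i, j))
      - complex_of_real (scalar_polynomial q g t) * (if i = j then 1 else 0)"
    using ij by (simp add: pencil_def matrix_polynomial_def)
  also have "\<dots> = (\<Sum>k\<le>?r. complex_of_real (t ^ k) * ((if k \<le> p then L k $$ (i, j) else 0)
      - (if k \<le> q then complex_of_real (g k) else 0) * (if i = j then 1 else 0)))"
    unfolding L_sum g_sum by (simp add: sum_subtractf[symmetric] algebra_simps)
  also have "\<dots> = (\<Sum>k\<le>?r. complex_of_real (t ^ k) * pencil_coeff n p L q g k $$ (i, j))"
    using ij L by (intro sum.cong refl) (auto simp: pencil_coeff_def)
  finally show ?thesis .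
qed

text \<open>The scale is \<open>t ^ max p q\<close>, which leaves only the top coefficient in the
  limit. Reflection multiplies the coefficient of \<open>t ^ k\<close> by \<open>(-1) ^ k\<close>,
  whence the sign at the other end.\<close>

lemma Z_down_pencil:
  assumes L: "\<And>k. k \<le> p \<Longrightarrow> L k \<in> carrier_mat n n"
    and curves: "eigenvalue_curves n (pencil n p L q g) \<mu>"
    and B_def: "B = pencil_coeff n p L q g (max p q)" and det: "det B \<noteq> 0"
  shows "Z_down_pinf n \<mu> = num_neg_eigenvalues B"
    and "Z_down_minf n \<mu> = num_neg_eigenvalues ((-1) ^ max p q \<cdot>\<^sub>m B)"
proof -
  let ?r = "max p q" and ?C = "pencil_coeff n p L q g"
  have B: "B \<in> carrier_mat n n"
    by (simp add: B_def)
  have entry: "pencil n p L q g t $$ (i, j) =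
      (\<Sum>k\<le>?r. complex_of_real (t ^ k) * ?C k $$ (i, j))" if "i < n" "j < n" for i j t
    using pencil_entry L that by blast
  have cont: "continuous_on S (\<mu> i)" if "i < n" for i S
    using curves that by (auto simp: eigenvalue_curves_def intro: real_analytic_imp_continuous_on)
  have mult: "alg_multiplicity (pencil n p L q g t) z =
      card {i. i < n \<and> complex_of_real (\<mu> i t) = z}" for t z
    using curves by (auto simp: eigenvalue_curves_def)
  have pos: "\<forall>\<^sub>F t::real in at_top. t ^ ?r > 0"
    using eventually_gt_at_top[of 0] by eventually_elim simp
  show "Z_down_pinf n \<mu> = num_neg_eigenvalues B"
  proof (rule Z_down_pinf_eq_num_neg_eigenvalues[OF _ B det cont mult pos])
    fix i j assume ij: "i < n" "j < n"
    show "((\<lambda>t. pencil n p L q g t $$ (i, j) / complex_of_real (t ^ ?r)) \<longlongrightarrow> B $$ (i, j)) at_top"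
      unfolding entry[OF ij] B_def by (rule polynomial_over_power_tendsto)
  qed simp_all
  show "Z_down_minf n \<mu> = num_neg_eigenvalues ((-1) ^ ?r \<cdot>\<^sub>m B)"
    unfolding Z_down_minf_eq_reflect
  proof (rule Z_down_pinf_eq_num_neg_eigenvalues[OF _ _ _ _ mult pos])
    fix i j assume ij: "i < n" "j < n"
    have "((\<lambda>t. (\<Sum>k\<le>?r. complex_of_real (t ^ k) * ((-1) ^ k * ?C k $$ (i, j))) / complex_of_real (t ^ ?r))
        \<longlongrightarrow> (-1) ^ ?r * ?C ?r $$ (i, j)) at_top"
      by (rule polynomial_over_power_tendsto)
    moreover have "complex_of_real (t ^ k) * ((-1) ^ k * z) = complex_of_real ((- t) ^ k) * z" for t k z
      by (subst power_minus[of t]) (simp del: of_real_power add: of_real_power[of "-1"])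
    ultimately show "((\<lambda>t. pencil n p L q g (- t) $$ (i, j) / complex_of_real (t ^ ?r))
        \<longlongrightarrow> ((-1) ^ ?r \<cdot>\<^sub>m B) $$ (i, j)) at_top"
      using ij carrier_matD[OF B] unfolding entry[OF ij] by (simp only: index_smult_mat) (simp only: B_def)
  next
    fix i assume "i < n"
    then show "continuous_on UNIV (\<lambda>t. \<mu> i (- t))"
      by (intro continuous_on_compose2[OF cont[of i UNIV]] continuous_intros) auto
  qed (use B det in auto)
qed

text \<open>The top coefficient is \<open>- g q\<close> times the identity, \<open>L p\<close>, or
  their sum, according to whether q > p, q < p or q = p. In the last case a singular sum allows
  curves of slower growth, whose signs depend on lower-order terms: L(t) = diag(t - 1, 2 t) and g(t)
  = t give the curves -1 and t, but the top coefficient diag(0, 1) has no negative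
  eigenvalue.\<close>

theorem theorem5:
  fixes n p q :: nat
    and L :: "nat \<Rightarrow> complex mat"
    and g :: "nat \<Rightarrow> real"
    and \<mu> :: "nat \<Rightarrow> real \<Rightarrow> real"
  assumes L_carrier: "\<And>k. k \<le> p \<Longrightarrow> L k \<in> carrier_mat n n"
    and L_hermitian: "\<And>k. k \<le> p \<Longrightarrow> hermitian_mat (L k)"
    and leading: "(\<lambda>t::real. complex_of_real (t ^ p) \<cdot>\<^sub>m L p)
                    \<noteq> (\<lambda>t::real. complex_of_real (t ^ q * g q) \<cdot>\<^sub>m 1\<^sub>m n)"
    and L_p_invertible: "invertible_mat (L p)"
    and curves: "eigenvalue_curves n (pencil n p L q g) \<mu>"
  shows "(q > p \<and> even q \<and> g q > 0 \<longrightarrow> Z_down_minf n \<mu> = n \<and> Z_down_pinf n \<mu> = n) \<and>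
    (q > p \<and> even q \<and> g q < 0 \<longrightarrow> Z_down_minf n \<mu> = 0 \<and> Z_down_pinf n \<mu> = 0) \<and>
    (q > p \<and> odd q \<and> g q > 0 \<longrightarrow> Z_down_minf n \<mu> = 0 \<and> Z_down_pinf n \<mu> = n) \<and>
    (q > p \<and> odd q \<and> g q < 0 \<longrightarrow> Z_down_minf n \<mu> = n \<and> Z_down_pinf n \<mu> = 0) \<and>
    (q < p \<longrightarrow>
       Z_down_minf n \<mu> = num_neg_eigenvalues ((-1) ^ p \<cdot>\<^sub>m L p) \<and>
       Z_down_pinf n \<mu> = num_neg_eigenvalues (L p)) \<and>
    (q = p \<and> invertible_mat (L p - complex_of_real (g p) \<cdot>\<^sub>m 1\<^sub>m n) \<longrightarrow>
       Z_down_minf n \<mu> =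
         num_neg_eigenvalues ((-1) ^ p \<cdot>\<^sub>m (L p - complex_of_real (g p) \<cdot>\<^sub>m 1\<^sub>m n)) \<and>
       Z_down_pinf n \<mu> = num_neg_eigenvalues (L p - complex_of_real (g p) \<cdot>\<^sub>m 1\<^sub>m n))"
proof -
  let ?B = "pencil_coeff n p L q g (max p q)"
  have Z: "Z_down_pinf n \<mu> = num_neg_eigenvalues ?B"
      "Z_down_minf n \<mu> = num_neg_eigenvalues ((-1) ^ max p q \<cdot>\<^sub>m ?B)"
    if "det ?B \<noteq> 0"
    using Z_down_pencil[OF _ curves refl that] L_carrier by blast+
  have Lp: "L p \<in> carrier_mat n n"
    using L_carrier by simp
  have gt: "?B = complex_of_real (- g q) \<cdot>\<^sub>m 1\<^sub>m n" if "q > p"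
    using that by (intro eq_matI) (auto simp: pencil_coeff_def)
  have lt: "?B = L p" if "q < p"
    using that Lp by (intro eq_matI) (auto simp: pencil_coeff_def)
  have eq: "?B = L p - complex_of_real (g p) \<cdot>\<^sub>m 1\<^sub>m n" if "q = p"
    using that by (simp add: pencil_coeff_def)
  \<comment> \<open>The sign of \<open>(-1) ^ q * g q\<close> treats the four parity cases at
    once.\<close>
  have "Z_down_pinf n \<mu> = (if g q > 0 then n else 0) \<and>
      Z_down_minf n \<mu> = (if (-1) ^ q * g q > 0 then n else 0)" if "q > p" "g q \<noteq> 0"
  proof -
    have "det ?B \<noteq> 0"
      unfolding gt[OF that(1)] using that(2) by simp
    moreover have "(-1) ^ q \<cdot>\<^sub>m (complex_of_real (- g q) \<cdot>\<^sub>m 1\<^sub>m n) =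
        complex_of_real (- ((-1) ^ q * g q)) \<cdot>\<^sub>m 1\<^sub>m n"
      by (intro eq_matI) auto
    moreover have "max p q = q"
      using that(1) by simp
    ultimately have "Z_down_pinf n \<mu> = num_neg_eigenvalues (complex_of_real (- g q) \<cdot>\<^sub>m 1\<^sub>m n)"
      "Z_down_minf n \<mu> = num_neg_eigenvalues (complex_of_real (- ((-1) ^ q * g q)) \<cdot>\<^sub>m 1\<^sub>m n)"
      using Z gt[OF that(1)] by metis+
    then show ?thesis
      by (simp only: num_neg_eigenvalues_scalar neg_less_0_iff_less)
  qed
  moreover have "Z_down_minf n \<mu> = num_neg_eigenvalues ((-1) ^ p \<cdot>\<^sub>m L p) \<and>
      Z_down_pinf n \<mu> = num_neg_eigenvalues (L p)" if "q < p"
    using Z invertible_mat_imp_det_nonzero[OF L_p_invertible Lp] lt[OF that] that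
    by (simp add: max_def)
  moreover have "Z_down_minf n \<mu> =
        num_neg_eigenvalues ((-1) ^ p \<cdot>\<^sub>m (L p - complex_of_real (g p) \<cdot>\<^sub>m 1\<^sub>m n)) \<and>
      Z_down_pinf n \<mu> = num_neg_eigenvalues (L p - complex_of_real (g p) \<cdot>\<^sub>m 1\<^sub>m n)"
    if "q = p" "invertible_mat (L p - complex_of_real (g p) \<cdot>\<^sub>m 1\<^sub>m n)"
  proof -
    have "det ?B \<noteq> 0"
      unfolding eq[OF that(1)] by (rule invertible_mat_imp_det_nonzero[OF that(2), of n]) (simp add: minus_carrier_mat)
    then show ?thesis
      using Z eq[OF that(1)] that(1) by simp
  qed
  ultimately show ?thesis
    by auto
qed

end
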